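(* Let $G$ be a finite connected simple graph and let $k\ge 2$. Let $(b,d)\in \mathrm{PD}_k(G)$ correspond to the $k$-dimensional homology class $\Omega\in H_k(\widehat{G}^b)$, and let $\omega(\Omega)$ be the width of $\Omega$ in $\widehat{G}^b$. Then $$d\le (\omega(\Omega)+1)\,b.$$
   Context: All homology is simplicial homology with $\mathbb{Z}/2\mathbb{Z}$ coefficients. For a finite connected simple graph $G$ with vertex set $\mathcal{V}$, let $\rho(v,w)$ be the number of edges in a shortest path in $G$ from $v$ to $w$, and let $D=\operatorname{diam}(G)=\max_{v,w\in\mathcal{V}}\rho(v,w)$. For an integer $n\ge 0$, the graph power $G^n$ has vertex set $\mathcal{V}$ and an edge between distinct vertices $v,w$ whenever $\rho(v,w)\le n$. Let $\widehat{G}^n$ be the clique complex of $G^n$: the simplicial complex on $\mathcal{V}$ whose simplices are the nonempty finite sets of vertices with pairwise $\rho$-distances at most $n$. The power filtration is $\widehat{G}^0\subset\widehat{G}^1\subset\cdots\subset\widehat{G}^D$. Persistence diagram: the persistence module $H_k(\widehat{G}^0)\to H_k(\widehat{G}^1)\to\cdots\to H_k(\widehat{G}^D)$ (maps induced by inclusions) decomposes uniquely up to reordering as a direct sum $\bigoplus_{i=1}^N \mathbb{I}_{b_i,d_i}$ of interval modules with $b_i<d_i$, where $\mathbb{I}_{b,d}$ is $\mathbb{Z}/2\mathbb{Z}$ at indices $b,\ldots,d-1$ with identity maps between them, and is $0$ elsewhere (by convention $d=\infty$ if the interval reaches index $D$; this does not occur for $k\ge 1$ because $\widehat{G}^D$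 is a full simplex). $\mathrm{PD}_k(G)$ is the multiset $\{(b_i,d_i)\mid 1\le i\le N\}$. A point $(b,d)\in\mathrm{PD}_k(G)$ corresponds to a class $\Omega\in H_k(\widehat{G}^b)$ if $\Omega$ is born in $\widehat{G}^b$ (it is not in the image of $H_k(\widehat{G}^{b-1})$) and first becomes homologous to earlier features in $\widehat{G}^d$ ($d$ is the smallest $n>b$ such that the image of $\Omega$ in $H_k(\widehat{G}^n)$ lies in the image of $H_k(\widehat{G}^{b-1})\to H_k(\widehat{G}^n)$). For $k\ge1$ all birth times satisfy $b\ge 1$. Width: for $b\ge1$ let $\rho_b(v,w)=\lceil \rho(v,w)/b\rceil$, which is the shortest path distance between $v$ and $w$ in the graph $G^b$. For $Y\subseteq\mathcal{V}$ let $\operatorname{diam}(Y)=\max_{y,y'\in Y}\rho_b(y,y')$ (distances are measured in $G^b$, and the diameter of the empty set is $0$). Let $M$ be a $k$-cycle in $\widehat{G}^b$, let $\mathcal{V}(M)$ be the set of vertices contained in at least one $k$-simplex of $M$, and for $v\in\mathcal{V}(M)$ let $f_v:\mathcal{V}(M)\to\mathbb{R}$, $f_v(w)=\rho_b(v,w)$, and $e_v=\max_{w\in\mathcal{V}(M)}\rho_b(v,w)$. The sweepout $\Lambda(v)$ is the collection of slices $\{f_v^{-1}(i)\mid 0\le i\le e_v\}$. The width of $M$ is $$\omega(M)=\min_{v\in\mathcal{V}(M)}\ \max_{0\le i\le e_v}\operatorname{diam}\left(f_v^{-1}(i)\right),$$ and the width of a homology class $\Omega\in H_k(\widehat{G}^b)$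 is $\omega(\Omega)=\min_{M}\omega(M)$, the minimum over all $k$-cycles $M$ in $\widehat{G}^b$ representing $\Omega$. *)

theory Defs
  imports
    "Graph_Theory.Pair_Digraph"
    "Graph_Theory.Digraph_Component"
    "HOL-Algebra.Elementary_Groups"
    "HOL-Algebra.Product_Groups"
    "HOL-Library.Extended_Nat"
    "HOL-Library.Multiset"
begin

section \<open>Distance, graph powers and the power filtration\<close>

definition graph_dist :: "'a pair_pre_digraph \<Rightarrow> 'a \<Rightarrow> 'a \<Rightarrow> nat" where
  "graph_dist G v w = (LEAST n. \<exists>p. pre_digraph.apath (with_proj G) v p w \<and> length p = n)"

definition graph_diam :: "'a pair_pre_digraph \<Rightarrow> nat" where
  "graph_diam G = Max {graph_dist G v w | v w. v \<in> pverts G \<and> w \<in> pverts G}"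

definition graph_power :: "'a pair_pre_digraph \<Rightarrow> nat \<Rightarrow> 'a pair_pre_digraph" where
  "graph_power G n =
     \<lparr>pverts = pverts G,
      parcs = {(v, w). v \<in> pverts G \<and> w \<in> pverts G \<and> v \<noteq> w \<and> graph_dist G v w \<le> n}\<rparr>"

text \<open>A simplicial complex is the set of its (nonempty, finite) simplices.\<close>

definition clique_complex :: "'a pair_pre_digraph \<Rightarrow> 'a set set" where
  "clique_complex H =
     {s. s \<noteq> {} \<and> finite s \<and> s \<subseteq> pverts H \<and> (\<forall>v\<in>s. \<forall>w\<in>s. v \<noteq> w \<longrightarrow> (v, w) \<in> parcs H)}"

definition power_complex :: "'a pair_pre_digraph \<Rightarrow> nat \<Rightarrow> 'a set set" where
  "power_complex G n = clique_complex (graph_power G n)"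

section \<open>Simplicial homology with coefficients in Z/2Z\<close>

text \<open>
  A chain over Z/2Z is identified with its support, a finite set of simplices; addition is then
  symmetric difference. An additive map between vector spaces over Z/2Z is automatically linear,
  so these spaces are treated as groups, with the library's \<^const>\<open>hom\<close>, \<^const>\<open>iso\<close> and
  quotients.
\<close>

definition simplices :: "'a set set \<Rightarrow> nat \<Rightarrow> 'a set set" where
  "simplices X k = {s \<in> X. card s = k + 1}"

definition chain_group :: "'a set set \<Rightarrow> nat \<Rightarrow> 'a set set monoid" where
  "chain_group X k =
     \<lparr>carrier = {c. finite c \<and> c \<subseteq> simplices X k}, monoid.mult = (\<lambda>c c'. (c - c') \<union> (c' - c)), one = {}\<rparr>"

text \<open>
  The condition \<open>t \<noteq> {}\<close> makes the boundary of a 0-chain zero (homology is not reduced).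
\<close>

definition chain_boundary :: "'a set set \<Rightarrow> 'a set set" where
  "chain_boundary c = {t. t \<noteq> {} \<and> odd (card {s \<in> c. \<exists>v\<in>s. t = s - {v}})}"

definition cycles :: "'a set set \<Rightarrow> nat \<Rightarrow> 'a set set set" where
  "cycles X k = {c \<in> carrier (chain_group X k). chain_boundary c = {}}"

definition boundaries :: "'a set set \<Rightarrow> nat \<Rightarrow> 'a set set set" where
  "boundaries X k = chain_boundary ` carrier (chain_group X (k + 1))"

text \<open>The elements are the cosets of \<open>boundaries X k\<close>: a class is the set of cycles representing it.\<close>

definition homology :: "'a set set \<Rightarrow> nat \<Rightarrow> 'a set set set monoid" where
  "homology X k = (chain_group X k\<lparr>carrier := cycles X k\<rparr>) Mod (boundaries X k)"

text \<open>
  The map from \<open>homology X k\<close> to \<open>homology Y k\<close> induced by an inclusion of \<open>X\<close> in \<open>Y\<close>: a coset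
  \<open>z + boundaries X k\<close> is sent to \<open>z + boundaries Y k\<close>.
\<close>

definition homology_incl :: "'a set set \<Rightarrow> nat \<Rightarrow> 'a set set set \<Rightarrow> 'a set set set" where
  "homology_incl Y k \<Omega> = boundaries Y k <#>\<^bsub>chain_group Y k\<^esub> \<Omega>"

section \<open>Persistence diagrams\<close>

text \<open>
  A persistence module with index set \<open>{0..D}\<close> is given by the groups \<open>V n\<close> and the structure maps
  \<open>\<phi> m n\<close> from \<open>V m\<close> to \<open>V n\<close> for \<open>m \<le> n\<close>.
\<close>

definition interval_module :: "nat \<Rightarrow> enat \<Rightarrow> nat \<Rightarrow> int monoid" where
  "interval_module b d n = integer_mod_group (if b \<le> n \<and> enat n < d then 2 else 1)"

definition interval_map :: "nat \<Rightarrow> enat \<Rightarrow> nat \<Rightarrow> nat \<Rightarrow> int \<Rightarrow> int" where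
  "interval_map b d m n x = (if b \<le> m \<and> enat n < d then x else 0)"

definition interval_sum :: "(nat \<times> enat) list \<Rightarrow> nat \<Rightarrow> (nat \<Rightarrow> int) monoid" where
  "interval_sum I n =
     sum_group {..<length I} (\<lambda>i. interval_module (fst (I ! i)) (snd (I ! i)) n)"

definition interval_sum_map ::
    "(nat \<times> enat) list \<Rightarrow> nat \<Rightarrow> nat \<Rightarrow> (nat \<Rightarrow> int) \<Rightarrow> (nat \<Rightarrow> int)" where
  "interval_sum_map I m n x =
     (\<lambda>i\<in>{..<length I}. interval_map (fst (I ! i)) (snd (I ! i)) m n (x i))"

text \<open>
  An interval reaching the last index \<open>D\<close> is given the endpoint \<open>\<infinity>\<close>; any other endpoint is at
  most \<open>D\<close>.
\<close>

definition interval_decomposition ::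
    "nat \<Rightarrow> (nat \<Rightarrow> 'c monoid) \<Rightarrow> (nat \<Rightarrow> nat \<Rightarrow> 'c \<Rightarrow> 'c) \<Rightarrow> (nat \<times> enat) list \<Rightarrow> bool" where
  "interval_decomposition D V \<phi> I \<longleftrightarrow>
     (\<forall>(b, d) \<in> set I. b \<le> D \<and> enat b < d \<and> (d \<le> enat D \<or> d = \<infinity>)) \<and>
     (\<exists>\<Phi>. (\<forall>n\<le>D. \<Phi> n \<in> iso (interval_sum I n) (V n)) \<and>
          (\<forall>n\<le>D. \<forall>m\<le>n. \<forall>x \<in> carrier (interval_sum I m).
             \<Phi> n (interval_sum_map I m n x) = \<phi> m n (\<Phi> m x)))"

text \<open>
  \<open>P\<close> is the persistence diagram of degree \<open>k\<close> of \<open>G\<close>. It is introduced by a predicate because its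
  existence and uniqueness are the structure theorem for persistence modules.
\<close>

definition is_PD :: "'a pair_pre_digraph \<Rightarrow> nat \<Rightarrow> (nat \<times> enat) multiset \<Rightarrow> bool" where
  "is_PD G k P \<longleftrightarrow>
     (\<exists>I. mset I = P \<and>
        interval_decomposition (graph_diam G)
          (\<lambda>n. homology (power_complex G n) k)
          (\<lambda>m n. homology_incl (power_complex G n) k) I)"

text \<open>
  The image of the homology of the complex with index \<open>b - 1\<close> in that of the complex with index \<open>n\<close>.
  There is no complex before index 0, so for \<open>b = 0\<close> this is the zero subgroup.
\<close>

definition earlier_classes :: "'a pair_pre_digraph \<Rightarrow> nat \<Rightarrow> nat \<Rightarrow> nat \<Rightarrow> 'a set set set set" where
  "earlier_classes G k b n =
     (if b = 0 then {\<one>\<^bsub>homology (power_complex G n) k\<^esub>}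
      else homology_incl (power_complex G n) k ` carrier (homology (power_complex G (b - 1)) k))"

text \<open>The infimum is \<open>\<infinity>\<close> if the class never becomes homologous to earlier features.\<close>

definition corresponds ::
    "'a pair_pre_digraph \<Rightarrow> nat \<Rightarrow> nat \<Rightarrow> enat \<Rightarrow> 'a set set set \<Rightarrow> bool" where
  "corresponds G k b d \<Omega> \<longleftrightarrow>
     \<Omega> \<in> carrier (homology (power_complex G b) k) \<and>
     \<Omega> \<notin> earlier_classes G k b b \<and>
     d = (INF n \<in> {n. b < n \<and> n \<le> graph_diam G \<and>
                      homology_incl (power_complex G n) k \<Omega> \<in> earlier_classes G k b n}. enat n)"

section \<open>Width\<close>

definition power_dist :: "'a pair_pre_digraph \<Rightarrow> nat \<Rightarrow> 'a \<Rightarrow> 'a \<Rightarrow> nat" where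
  "power_dist G b v w = nat \<lceil>real (graph_dist G v w) / real b\<rceil>"

definition set_diam :: "'a pair_pre_digraph \<Rightarrow> nat \<Rightarrow> 'a set \<Rightarrow> nat" where
  "set_diam G b Y =
     (if Y = {} then 0 else Max {power_dist G b y y' | y y'. y \<in> Y \<and> y' \<in> Y})"

definition chain_verts :: "'a set set \<Rightarrow> 'a set" where
  "chain_verts M = \<Union>M"

definition slice :: "'a pair_pre_digraph \<Rightarrow> nat \<Rightarrow> 'a set set \<Rightarrow> 'a \<Rightarrow> nat \<Rightarrow> 'a set" where
  "slice G b M v i = {w \<in> chain_verts M. power_dist G b v w = i}"

definition eccentricity :: "'a pair_pre_digraph \<Rightarrow> nat \<Rightarrow> 'a set set \<Rightarrow> 'a \<Rightarrow> nat" where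
  "eccentricity G b M v = Max (power_dist G b v ` chain_verts M)"

text \<open>
  Only used for nonempty cycles: the zero cycle does not represent a class that is born in a
  complex of the filtration.
\<close>

definition cycle_width :: "'a pair_pre_digraph \<Rightarrow> nat \<Rightarrow> 'a set set \<Rightarrow> nat" where
  "cycle_width G b M =
     Min ((\<lambda>v. Max ((\<lambda>i. set_diam G b (slice G b M v i)) ` {0..eccentricity G b M v}))
          ` chain_verts M)"

definition class_width :: "'a pair_pre_digraph \<Rightarrow> nat \<Rightarrow> 'a set set set \<Rightarrow> nat" where
  "class_width G b \<Omega> = Min (cycle_width G b ` \<Omega>)"

end

theory Submission
  imports Defs
begin

text \<open>
  Sweep a cycle \<open>M\<close> of minimal width \<open>\<omega>\<close> by the levels \<open>f = \<rho>\<^sub>b(v, -)\<close>. Every simplex of \<open>M\<close> meets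
  at most two consecutive levels. Let \<open>z\<^sub>n\<close> consist of the simplices that reach below level
  \<open>n\<close>. As \<open>M\<close> is a cycle, the boundary of \<open>z\<^sub>n\<close> lies in level \<open>n\<close>; it is a cycle of positive
  dimension (here \<open>k \<ge> 2\<close> enters), so it bounds a cone \<open>C\<^sub>n\<close> in that level. The cycle
  \<open>z\<^sub>n + C\<^sub>n + z\<^sub>n\<^sub>+\<^sub>1 + C\<^sub>n\<^sub>+\<^sub>1\<close> has all its vertices in level \<open>n\<close> or in level \<open>n + 1\<close> adjacent to
  level \<open>n\<close>. These are pairwise at distance at most \<open>(\<omega> + 1) b\<close>, so the cycle bounds at that
  scale. Summing over \<open>n\<close> shows that \<open>M\<close> bounds there.
\<close>

section \<open>Chains modulo 2\<close>

lemma odd_card_sym_diff: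
  assumes "finite A" "finite B"
  shows "odd (card (sym_diff A B)) \<longleftrightarrow> odd (card A) \<noteq> odd (card B)"
proof -
  have "card (sym_diff A B) = card (A - B) + card (B - A)"
    using assms by (intro card_Un_disjoint) auto
  moreover have "card A = card (A - B) + card (A \<inter> B)"
    using assms(1) by (simp add: card_Diff_subset_Int card_mono)
  moreover have "card B = card (B - A) + card (A \<inter> B)"
    using assms by (simp add: card_Diff_subset_Int card_mono Int_commute)
  ultimately show ?thesis by auto
qed

text \<open>Linearity over Z/2Z: selecting the simplices that have \<open>t\<close> as a facet
  commutes with symmetric difference. Finiteness enters because \<open>card\<close> is 0 on infinite
  sets, where parity is lost.\<close>

lemma chain_boundary_sym_diff:
  assumes "finite c" "finite c'"
  shows "chain_boundary (sym_diff c c') = sym_diff (chain_boundary c) (chain_boundary c')"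
proof -
  have "odd (card {s \<in> sym_diff c c'. \<exists>v\<in>s. t = s - {v}}) \<longleftrightarrow>
      odd (card {s \<in> c. \<exists>v\<in>s. t = s - {v}}) \<noteq> odd (card {s \<in> c'. \<exists>v\<in>s. t = s - {v}})" for t
  proof -
    have "{s \<in> sym_diff c c'. \<exists>v\<in>s. t = s - {v}} =
        sym_diff {s \<in> c. \<exists>v\<in>s. t = s - {v}} {s \<in> c'. \<exists>v\<in>s. t = s - {v}}"
      by blast
    then show ?thesis
      using assms by (simp only:) (rule odd_card_sym_diff; simp)
  qed
  then show ?thesis
    unfolding chain_boundary_def by blast
qed

lemma chain_boundary_empty [simp]: "chain_boundary {} = {}"
  by (simp add: chain_boundary_def)

lemma chain_boundary_face:
  assumes "t \<in> chain_boundary c"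
  obtains s v where "s \<in> c" "v \<in> s" "t = s - {v}" "t \<noteq> {}"
proof -
  have "{s \<in> c. \<exists>v\<in>s. t = s - {v}} \<noteq> {}" "t \<noteq> {}"
    using assms unfolding chain_boundary_def by (auto simp del: Collect_empty_eq)
  then show ?thesis using that by blast
qed

lemma finite_chain_boundary:
  assumes "finite c" "\<forall>s\<in>c. finite s"
  shows "finite (chain_boundary c)"
proof (rule finite_subset)
  show "chain_boundary c \<subseteq> Pow (\<Union>c)"
    by (auto elim!: chain_boundary_face)
  show "finite (Pow (\<Union>c))" using assms by auto
qed

lemma chain_boundary_singleton:
  "chain_boundary {r} = {t. t \<noteq> {} \<and> (\<exists>v\<in>r. t = r - {v})}"
proof -
  have "{s \<in> {r}. \<exists>v\<in>s. t = s - {v}} = (if \<exists>v\<in>r. t = r - {v} then {r} else {})" for t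
    by auto
  then show ?thesis unfolding chain_boundary_def by auto
qed

text \<open>Removing two vertices \<open>a\<close>, \<open>b\<close> from \<open>r\<close> leaves a
  facet of exactly two facets of \<open>r\<close>, namely \<open>r - {a}\<close> and
  \<open>r - {b}\<close>; any other nonempty set is a facet of none.\<close>

lemma chain_boundary_boundary_singleton: "chain_boundary (chain_boundary {r}) = {}"
proof -
  have "even (card {s \<in> chain_boundary {r}. \<exists>v\<in>s. t = s - {v}})" if "t \<noteq> {}" for t
  proof (cases "\<exists>a b. a \<in> r \<and> b \<in> r \<and> a \<noteq> b \<and> t = r - {a} - {b}")
    case True
    then obtain a b where ab: "a \<in> r" "b \<in> r" "a \<noteq> b" "t = r - {a} - {b}" by blast
    have "{s \<in> chain_boundary {r}. \<exists>v\<in>s. t = s - {v}} = {r - {a}, r - {b}}"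
      unfolding chain_boundary_singleton
    proof (intro subset_antisym subsetI)
      fix s assume "s \<in> {s \<in> {t. t \<noteq> {} \<and> (\<exists>v\<in>r. t = r - {v})}. \<exists>v\<in>s. t = s - {v}}"
      then obtain x y where "x \<in> r" "s = r - {x}" "y \<in> s" "t = s - {y}" by blast
      then have "x \<notin> t" by blast
      then have "x = a \<or> x = b" using ab \<open>x \<in> r\<close> by blast
      then show "s \<in> {r - {a}, r - {b}}" using \<open>s = r - {x}\<close> by blast
    next
      fix s assume "s \<in> {r - {a}, r - {b}}"
      then consider "s = r - {a}" "t = s - {b}" "b \<in> s" | "s = r - {b}" "t = s - {a}" "a \<in> s"
        using ab by auto
      then show "s \<in> {s \<in> {t. t \<noteq> {} \<and> (\<exists>v\<in>r. t = r - {v})}. \<exists>v\<in>s. t = s - {v}}"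
        using ab(1,2) that by cases blast+
    qed
    moreover have "r - {a} \<noteq> r - {b}" using ab by blast
    ultimately show ?thesis by simp
  next
    case False
    then have "{s \<in> chain_boundary {r}. \<exists>v\<in>s. t = s - {v}} = {}"
      unfolding chain_boundary_singleton by blast
    then show ?thesis by (simp only: card.empty even_zero)
  qed
  then show ?thesis unfolding chain_boundary_def[of "chain_boundary {r}"] by blast
qed

lemma chain_boundary_boundary:
  assumes "finite c" "\<forall>s\<in>c. finite s"
  shows "chain_boundary (chain_boundary c) = {}"
  using assms
proof (induction c rule: finite_induct)
  case (insert r c)
  have "insert r c = sym_diff {r} c" using insert.hyps by auto
  then have "chain_boundary (insert r c) = sym_diff (chain_boundary {r}) (chain_boundary c)"
    using chain_boundary_sym_diff[of "{r}" c] insert.hyps by simp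
  moreover have "finite (chain_boundary {r})" "finite (chain_boundary c)"
    using insert by (auto intro!: finite_chain_boundary)
  ultimately show ?case
    using chain_boundary_sym_diff[of "chain_boundary {r}" "chain_boundary c"]
      chain_boundary_boundary_singleton[of r] insert by simp
qed simp

text \<open>The cone with apex \<open>v\<close> over a cycle of positive dimension. Simplices
  already containing \<open>v\<close> are left out, as their cones would be degenerate; the cycle
  condition restores them in the boundary.\<close>

lemma chain_boundary_cone:
  assumes "finite z" "\<forall>s\<in>z. 2 \<le> card s" "chain_boundary z = {}"
  shows "chain_boundary (insert v ` {s \<in> z. v \<notin> s}) = z"
proof -
  let ?c = "insert v ` {s \<in> z. v \<notin> s}"
  have ne: "t \<noteq> {}" if "t \<in> z" for t using assms(2) that by force
  have "odd (card {s \<in> ?c. \<exists>u\<in>s. t = s - {u}}) \<longleftrightarrow> t \<in> z" if t: "t \<noteq> {}" for t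
  proof (cases "v \<in> t")
    case False
    have "{s \<in> ?c. \<exists>u\<in>s. t = s - {u}} = (if t \<in> z then {insert v t} else {})"
    proof (intro subset_antisym subsetI)
      fix s assume "s \<in> {s \<in> ?c. \<exists>u\<in>s. t = s - {u}}"
      then obtain s' u where "s = insert v s'" "s' \<in> z" "v \<notin> s'" "t = s - {u}" by blast
      moreover from this have "u = v" using False by blast
      ultimately have "t = s'" by blast
      then show "s \<in> (if t \<in> z then {insert v t} else {})"
        using \<open>s' \<in> z\<close> \<open>s = insert v s'\<close> by simp
    next
      fix s assume "s \<in> (if t \<in> z then {insert v t} else {})"
      then have "t \<in> z" "s = insert v t" by (auto split: if_splits)
      then show "s \<in> {s \<in> ?c. \<exists>u\<in>s. t = s - {u}}" using False by auto
    qed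
    then show ?thesis by simp
  next
    case True
    \<comment> \<open>The members of \<open>A\<close> avoiding \<open>v\<close> correspond, by
      adding \<open>v\<close>, to the simplices of the cone with facet \<open>t\<close>; the only
      possible member containing \<open>v\<close> is \<open>t\<close> itself. As
      \<open>card A\<close> is even, both counts have the same parity.\<close>
    define A where "A = {s \<in> z. \<exists>u\<in>s. t - {v} = s - {u}}"
    have "{s \<in> ?c. \<exists>u\<in>s. t = s - {u}} = insert v ` {s \<in> A. v \<notin> s}"
    proof (intro subset_antisym subsetI)
      fix s assume "s \<in> {s \<in> ?c. \<exists>u\<in>s. t = s - {u}}"
      then obtain s' u where s: "s = insert v s'" "s' \<in> z" "v \<notin> s'" "t = s - {u}" "u \<in> s" by blast
      then have "u \<in> s'" "t - {v} = s' - {u}" using True by auto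
      then show "s \<in> insert v ` {s \<in> A. v \<notin> s}" using s unfolding A_def by blast
    next
      fix s assume "s \<in> insert v ` {s \<in> A. v \<notin> s}"
      then obtain s' u where s: "s = insert v s'" "s' \<in> z" "v \<notin> s'" "t - {v} = s' - {u}" "u \<in> s'"
        unfolding A_def by blast
      then have "u \<in> s" "t = s - {u}" using True by blast+
      then show "s \<in> {s \<in> ?c. \<exists>u\<in>s. t = s - {u}}" using s by blast
    qed
    moreover have "inj_on (insert v) {s \<in> A. v \<notin> s}"
      by (rule inj_onI) (metis (no_types, lifting) Diff_insert_absorb mem_Collect_eq)
    ultimately have "card {s \<in> ?c. \<exists>u\<in>s. t = s - {u}} = card {s \<in> A. v \<notin> s}"
      by (simp only: card_image)
    moreover have "even (card A)"
    \<comment> \<open>For \<open>t = {v}\<close> the cycle condition is silent, since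
      \<open>chain_boundary\<close> discards the empty face; here the bound
      \<open>2 \<le> card s\<close> makes \<open>A\<close> empty.\<close>
    proof (cases "t - {v} = {}")
      case True
      have False if "s \<in> z" "u \<in> s" "{} = s - {u}" for s u
      proof -
        have "s = {u}" using that by blast
        then show False using assms(2) that by force
      qed
      then have "A = {}" unfolding A_def True by blast
      then show ?thesis by simp
    next
      case False
      have "t - {v} \<notin> chain_boundary z" using assms(3) by simp
      then show ?thesis using False unfolding chain_boundary_def A_def by simp
    qed
    moreover have "{s \<in> A. v \<in> s} = (if t \<in> z then {t} else {})"
    proof (intro subset_antisym subsetI)
      fix s assume "s \<in> {s \<in> A. v \<in> s}"
      then obtain u where s: "s \<in> z" "u \<in> s" "t - {v} = s - {u}" "v \<in> s" unfolding A_def by blast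
      then have "u = v" by blast
      then have "s = t" using s True by blast
      then show "s \<in> (if t \<in> z then {t} else {})" using s by simp
    next
      fix s assume "s \<in> (if t \<in> z then {t} else {})"
      then show "s \<in> {s \<in> A. v \<in> s}" using True unfolding A_def by (auto split: if_splits)
    qed
    moreover have "card A = card {s \<in> A. v \<in> s} + card {s \<in> A. v \<notin> s}"
    proof -
      have "finite A" unfolding A_def using assms(1) by simp
      moreover have "A = {s \<in> A. v \<in> s} \<union> {s \<in> A. v \<notin> s}" by blast
      ultimately show ?thesis
        by (metis (no_types, lifting) card_Un_disjoint disjoint_iff finite_Un mem_Collect_eq)
    qed
    ultimately show ?thesis by (auto split: if_splits)
  qed
  then show ?thesis using ne unfolding chain_boundary_def by blast
qed

text \<open>The full simplex on \<open>B\<close> is acyclic in positive degree, by coning from a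
  vertex of \<open>B\<close>. A simplex of \<open>z\<close> supplies the apex; when \<open>z\<close>
  is empty, \<open>B\<close> may be empty too, and the empty chain serves.\<close>

lemma cycle_in_simplex_bounds:
  assumes "finite z" "z \<subseteq> {s. s \<subseteq> B \<and> card s = k + 1}" "1 \<le> k" "chain_boundary z = {}"
  obtains c where "finite c" "c \<subseteq> {s. s \<subseteq> B \<and> finite s \<and> card s = k + 2}" "chain_boundary c = z"
proof (cases "z = {}")
  case True
  then show ?thesis using that[of "{}"] by simp
next
  case False
  then obtain s where s: "s \<in> z" by blast
  then have "s \<noteq> {}" using assms(2) by force
  then obtain v where "v \<in> B" using s assms(2) by blast
  have fin: "finite s" if "s \<in> z" for s
    using assms(2) that by (intro card_ge_0_finite) auto
  show ?thesis
  proof (rule that)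
    show "finite (insert v ` {s \<in> z. v \<notin> s})" using assms(1) by simp
    show "insert v ` {s \<in> z. v \<notin> s} \<subseteq> {s. s \<subseteq> B \<and> finite s \<and> card s = k + 2}"
      using \<open>v \<in> B\<close> fin assms(2) by auto
    show "chain_boundary (insert v ` {s \<in> z. v \<notin> s}) = z"
      using assms by (intro chain_boundary_cone) auto
  qed
qed

section \<open>Sweeping a cycle\<close>

text \<open>The sweep for an abstract level function \<open>f\<close> and a target complex
  \<open>X\<close>. The hypothesis \<open>fill\<close> admits only those vertices of level
  \<open>Suc n\<close> that share a simplex of \<open>M\<close> with level \<open>n\<close>: such a
  simplex is what controls their distance to level \<open>n\<close> in the application.\<close>

lemma swept_cycle_bounds:
  fixes f :: "'a \<Rightarrow> nat"
  assumes "finite M" "\<And>s. s \<in> M \<Longrightarrow> card s = k + 1" "2 \<le> k" "chain_boundary M = {}"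
    and level: "\<And>s x y. s \<in> M \<Longrightarrow> x \<in> s \<Longrightarrow> y \<in> s \<Longrightarrow> f y \<le> f x + 1"
    and fill: "\<And>n t. t \<subseteq> {w \<in> chain_verts M. f w = n} \<union>
            {w \<in> chain_verts M. f w = Suc n \<and> (\<exists>s\<in>M. w \<in> s \<and> (\<exists>x\<in>s. f x = n))} \<Longrightarrow>
          finite t \<Longrightarrow> card t = k + 2 \<Longrightarrow> t \<in> X"
  obtains c where "finite c" "c \<subseteq> X" "\<forall>s\<in>c. card s = k + 2" "chain_boundary c = M"
proof -
  define z where "z n = {s \<in> M. \<exists>x\<in>s. f x < n}" for n
  \<comment> \<open>\<open>U n\<close> is the part of level \<open>n\<close> that touches lower
    levels. Coning inside it, and not in the whole level, keeps the cone for \<open>Suc n\<close>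
    inside \<open>B n\<close>.\<close>
  define U where "U n = {w \<in> chain_verts M. f w = n \<and> (\<exists>s\<in>M. w \<in> s \<and> (\<exists>x\<in>s. f x < n))}" for n
  define B where "B n = {w \<in> chain_verts M. f w = n} \<union>
      {w \<in> chain_verts M. f w = Suc n \<and> (\<exists>s\<in>M. w \<in> s \<and> (\<exists>x\<in>s. f x = n))}" for n
  have finM: "finite s" if "s \<in> M" for s
    using assms(2)[OF that] by (intro card_ge_0_finite) simp
  have finz: "finite (z n)" for n using assms(1) unfolding z_def by simp
  have UB: "U n \<subseteq> B n" "U (Suc n) \<subseteq> B n" for n
  proof -
    show "U n \<subseteq> B n" unfolding U_def B_def by blast
    show "U (Suc n) \<subseteq> B n"
    proof
      fix w assume "w \<in> U (Suc n)"
      then obtain s x where w: "w \<in> chain_verts M" "f w = Suc n" "s \<in> M" "w \<in> s" "x \<in> s" "f x < Suc n"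
        unfolding U_def by blast
      then have "f x = n" using level[of s x w] by simp
      then show "w \<in> B n" using w unfolding B_def by blast
    qed
  qed
  \<comment> \<open>As \<open>M\<close> is a cycle, \<open>z n\<close> and \<open>M - z n\<close>
    have the same boundary. So \<open>t\<close> lies in a simplex with all levels at least
    \<open>n\<close>, and also in one reaching below \<open>n\<close>, whose levels are at most
    \<open>n\<close> by \<open>level\<close>.\<close>
  have bdU: "t \<subseteq> U n \<and> card t = k" if "t \<in> chain_boundary (z n)" for t n
  proof -
    have "chain_boundary (sym_diff M (z n)) = chain_boundary (z n)"
      using chain_boundary_sym_diff[OF assms(1) finz[of n]] assms(4) by simp
    moreover have "sym_diff M (z n) = M - z n" unfolding z_def by blast
    ultimately have "t \<in> chain_boundary (M - z n)" using that by simp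
    then obtain s' v' where s': "s' \<in> M - z n" "t = s' - {v'}" by (rule chain_boundary_face)
    from that obtain s v where s: "s \<in> z n" "v \<in> s" "t = s - {v}" by (rule chain_boundary_face)
    from s(1) obtain x where x: "s \<in> M" "x \<in> s" "f x < n" unfolding z_def by blast
    have "w \<in> U n" if "w \<in> t" for w
    proof -
      have "w \<in> s" "w \<in> s'" using that s s' by auto
      then have "n \<le> f w" using s' unfolding z_def by force
      moreover have "f w \<le> n" using level[OF x(1,2) \<open>w \<in> s\<close>] x(3) by simp
      ultimately show ?thesis using x \<open>w \<in> s\<close> unfolding U_def chain_verts_def by auto
    qed
    moreover have "card t = k" using s x assms(2)[of s] finM[of s] by simp
    ultimately show ?thesis by blast
  qed
  have cone: "\<exists>C. finite C \<and> C \<subseteq> {s. s \<subseteq> U n \<and> finite s \<and> card s = k + 1} \<and>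
      chain_boundary C = chain_boundary (z n)" for n
  proof -
    have fin: "finite (chain_boundary (z n))" and cyc: "chain_boundary (chain_boundary (z n)) = {}"
      using finz finM by (auto intro!: finite_chain_boundary chain_boundary_boundary simp: z_def)
    have sub: "chain_boundary (z n) \<subseteq> {s. s \<subseteq> U n \<and> card s = (k - 1) + 1}"
      using bdU assms(3) by simp blast
    \<comment> \<open>The boundary of \<open>z n\<close> has dimension \<open>k - 1\<close>;
      acyclicity of a simplex requires this to be positive.\<close>
    have "1 \<le> k - 1" using assms(3) by simp
    from fin sub this cyc obtain C where "finite C"
      "C \<subseteq> {s. s \<subseteq> U n \<and> finite s \<and> card s = (k - 1) + 2}" "chain_boundary C = chain_boundary (z n)"
      by (rule cycle_in_simplex_bounds)
    moreover have "(k - 1) + 2 = k + 1" using assms(3) by simp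
    ultimately show ?thesis by metis
  qed
  then obtain C where C: "\<And>n. finite (C n)"
    "\<And>n. C n \<subseteq> {s. s \<subseteq> U n \<and> finite s \<and> card s = k + 1}"
    "\<And>n. chain_boundary (C n) = chain_boundary (z n)"
    by metis
  have C_empty: "C n = {}" if "U n = {}" for n
    using C(2)[of n] that by force
  \<comment> \<open>Invariant: the sum of \<open>z n\<close> and \<open>C n\<close> bounds in
    \<open>X\<close>. It is trivial for \<open>n = 0\<close>, and becomes the claim once
    \<open>n\<close> exceeds all levels, where \<open>z n = M\<close> and \<open>C n\<close> is
    empty.\<close>
  have sweep: "\<exists>c. finite c \<and> c \<subseteq> {t \<in> X. card t = k + 2} \<and>
      chain_boundary c = sym_diff (z n) (C n)" for n
  proof (induction n)
    case 0
    have "U 0 = {}" "z 0 = {}" unfolding U_def z_def by auto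
    then show ?case using C_empty by (intro exI[of _ "{}"]) auto
  next
    case (Suc n)
    then obtain c where c: "finite c" "c \<subseteq> {t \<in> X. card t = k + 2}"
      "chain_boundary c = sym_diff (z n) (C n)" by blast
    define p where "p = sym_diff (sym_diff (z n) (C n)) (sym_diff (z (Suc n)) (C (Suc n)))"
    \<comment> \<open>Since \<open>z\<close> is increasing, the old simplices cancel. The two cones
      and the simplices with lowest level exactly \<open>n\<close> remain, and their vertices all
      lie in \<open>B n\<close>.\<close>
    have p_alt: "p = sym_diff (z (Suc n) - z n) (sym_diff (C n) (C (Suc n)))"
    proof -
      have "z n \<subseteq> z (Suc n)" unfolding z_def by force
      then show ?thesis unfolding p_def by blast
    qed
    have fin: "finite p" unfolding p_def using finz C(1) by blast
    have sub: "p \<subseteq> {s. s \<subseteq> B n \<and> card s = k + 1}"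
    proof
      fix s assume "s \<in> p"
      then consider "s \<in> z (Suc n) - z n" | "s \<in> C n" | "s \<in> C (Suc n)" unfolding p_alt by blast
      then show "s \<in> {s. s \<subseteq> B n \<and> card s = k + 1}"
      proof cases
        case 1
        then obtain x where x: "s \<in> M" "x \<in> s" "f x = n" and ge: "\<And>y. y \<in> s \<Longrightarrow> n \<le> f y"
          unfolding z_def by (auto simp: less_Suc_eq not_less)
        have "w \<in> B n" if "w \<in> s" for w
          using ge[OF that] level[OF x(1,2) that] x that
          unfolding B_def chain_verts_def by (auto simp: le_Suc_eq)
        then show ?thesis using assms(2) x(1) by blast
      qed (use C(2)[of n] C(2)[of "Suc n"] UB[of n] in blast)+
    qed
    have cyc: "chain_boundary p = {}"
    proof -
      have *: "chain_boundary (sym_diff (z m) (C m)) = {}" for m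
        using chain_boundary_sym_diff[OF finz[of m] C(1)[of m]] C(3)[of m] by simp
      have "finite (sym_diff (z m) (C m))" for m using finz C(1) by blast
      from chain_boundary_sym_diff[OF this[of n] this[of "Suc n"]] show ?thesis
        unfolding p_def by (simp only: *) simp
    qed
    have "1 \<le> k" using assms(3) by simp
    from fin sub this cyc obtain e where e: "finite e" "e \<subseteq> {s. s \<subseteq> B n \<and> finite s \<and> card s = k + 2}"
      "chain_boundary e = p"
      by (rule cycle_in_simplex_bounds)
    have "e \<subseteq> {t \<in> X. card t = k + 2}"
    proof
      fix t assume "t \<in> e"
      then have "t \<subseteq> B n" "finite t" "card t = k + 2" using e(2) by auto
      then show "t \<in> {t \<in> X. card t = k + 2}" using fill[of t n] unfolding B_def by simp
    qed
    then have "sym_diff c e \<subseteq> {t \<in> X. card t = k + 2}" using c(2) by blast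
    moreover have "chain_boundary (sym_diff c e) = sym_diff (z (Suc n)) (C (Suc n))"
      using chain_boundary_sym_diff[OF c(1) e(1)] c(3) e(3) unfolding p_def by blast
    moreover have "finite (sym_diff c e)" using c(1) e(1) by simp
    ultimately show ?case by (intro exI[of _ "sym_diff c e"] conjI)
  qed
  have "finite (f ` chain_verts M)" unfolding chain_verts_def using assms(1) finM by auto
  then obtain n where n: "\<And>w. w \<in> chain_verts M \<Longrightarrow> f w < n"
    using finite_nat_set_iff_bounded by auto
  then have "U n = {}" unfolding U_def by force
  moreover have "z n = M"
  proof -
    have "\<exists>x\<in>s. f x < n" if "s \<in> M" for s
    proof -
      have "s \<noteq> {}" using assms(2)[OF that] by force
      then show ?thesis using n that unfolding chain_verts_def by blast
    qed
    then show ?thesis unfolding z_def by blast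
  qed
  ultimately obtain c where "finite c" "c \<subseteq> {t \<in> X. card t = k + 2}" "chain_boundary c = M"
    using sweep[of n] C_empty[of n] by auto
  then show ?thesis using that by blast
qed

section \<open>Graph distance\<close>

context pair_graph
begin

text \<open>\<open>graph_dist\<close> minimises over walks without repeated vertices, so a walk is
  first cut down by deleting cycles, which cannot lengthen it. Concatenated walks can then serve in
  the triangle inequality.\<close>

lemma graph_dist_le_awalk:
  assumes "awalk u p v"
  shows "graph_dist G u v \<le> length p"
proof -
  have "length (awalk_to_apath p) \<le> length p"
    using assms
  proof (induct rule: awalk_to_apath_induct)
    case (path p)
    then have "awalk_to_apath p = p" by (auto simp: awalk_to_apath.simps)
    then show ?case by simp
  next
    case (decomp p q r s)
    then have "p = q @ r @ s" by (auto elim: awalk_cyc_decompE)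
    moreover have "awalk_to_apath p = awalk_to_apath (q @ s)"
      using decomp step_awalk_to_apath by blast
    ultimately show ?case using decomp by simp
  qed
  moreover have "graph_dist G u v \<le> length (awalk_to_apath p)"
    unfolding graph_dist_def using apath_awalk_to_apath[OF assms] by (intro Least_le) blast
  ultimately show ?thesis by simp
qed

text \<open>\<open>LEAST\<close> is attained only if some path exists. Connectedness provides one,
  because a connected symmetric digraph is strongly connected.\<close>

lemma graph_dist_awalk:
  assumes "Digraph_Component.connected (with_proj G)" "u \<in> pverts G" "v \<in> pverts G"
  obtains p where "awalk u p v" "length p = graph_dist G u v"
proof -
  have "strongly_connected (with_proj G)"
    using assms(1) symmetric_connected_imp_strongly_connected sym_arcs by blast
  then have "u \<rightarrow>\<^sup>*\<^bsub>with_proj G\<^esub> v"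
    using assms unfolding strongly_connected_def by simp
  then obtain q where "awalk u q v" using reachable_awalk by blast
  then have "\<exists>n p. apath u p v \<and> length p = n" using apath_awalk_to_apath by blast
  then have "\<exists>p. apath u p v \<and> length p = graph_dist G u v"
    unfolding graph_dist_def by (rule LeastI_ex)
  then show ?thesis using that unfolding apath_def by blast
qed

lemma graph_dist_triangle:
  assumes "Digraph_Component.connected (with_proj G)"
    and "u \<in> pverts G" "v \<in> pverts G" "w \<in> pverts G"
  shows "graph_dist G u w \<le> graph_dist G u v + graph_dist G v w"
proof -
  obtain p where p: "awalk u p v" "length p = graph_dist G u v"
    using graph_dist_awalk assms by blast
  obtain q where q: "awalk v q w" "length q = graph_dist G v w"
    using graph_dist_awalk assms by blast
  have "awalk u (p @ q) w" using p(1) q(1) by (rule awalk_appendI)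
  then have "graph_dist G u w \<le> length (p @ q)" by (rule graph_dist_le_awalk)
  then show ?thesis using p(2) q(2) by simp
qed

lemma graph_dist_eq_0_iff:
  assumes "Digraph_Component.connected (with_proj G)" "u \<in> pverts G" "v \<in> pverts G"
  shows "graph_dist G u v = 0 \<longleftrightarrow> u = v"
proof
  assume "graph_dist G u v = 0"
  then obtain p where "awalk u p v" "p = []" using graph_dist_awalk assms by (metis length_0_conv)
  then show "u = v" by (simp add: awalk_Nil_iff)
next
  assume "u = v"
  then have "awalk u [] v" using assms by (simp add: awalk_Nil_iff)
  then show "graph_dist G u v = 0" using graph_dist_le_awalk[of u "[]" v] by simp
qed

lemma graph_dist_le_diam:
  assumes "u \<in> pverts G" "v \<in> pverts G"
  shows "graph_dist G u v \<le> graph_diam G"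
proof -
  have "{graph_dist G v w |v w. v \<in> pverts G \<and> w \<in> pverts G} =
      (\<lambda>(v, w). graph_dist G v w) ` (pverts G \<times> pverts G)" by auto
  then have "finite {graph_dist G v w |v w. v \<in> pverts G \<and> w \<in> pverts G}"
    by (simp only:) simp
  then show ?thesis unfolding graph_diam_def using assms by (intro Max_ge) auto
qed

lemma power_complex_iff:
  "s \<in> power_complex G n \<longleftrightarrow>
    s \<noteq> {} \<and> s \<subseteq> pverts G \<and> (\<forall>v\<in>s. \<forall>w\<in>s. v \<noteq> w \<longrightarrow> graph_dist G v w \<le> n)"
proof -
  have "finite s" if "s \<subseteq> pverts G" using that by (meson finite_subset finite_verts)
  then show ?thesis
    unfolding power_complex_def clique_complex_def graph_power_def by auto
qed

lemma power_complex_mono: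
  assumes "m \<le> n"
  shows "power_complex G m \<subseteq> power_complex G n"
  using assms unfolding subset_iff power_complex_iff by (meson le_trans)

text \<open>The filtration is constant from the diameter on. The scale given by the width may exceed
  the diameter, whereas \<open>corresponds\<close> looks for death times only up to it.\<close>

lemma power_complex_min_diam: "power_complex G (min n (graph_diam G)) = power_complex G n"
proof -
  have "s \<in> power_complex G (min n (graph_diam G)) \<longleftrightarrow> s \<in> power_complex G n" for s
    unfolding power_complex_iff using graph_dist_le_diam by (meson min.bounded_iff subsetD)
  then show ?thesis by blast
qed

end

section \<open>Homology classes\<close>

lemma chain_group_simps [simp]:
  "c \<in> carrier (chain_group X k) \<longleftrightarrow> finite c \<and> c \<subseteq> simplices X k"
  "c \<otimes>\<^bsub>chain_group X k\<^esub> c' = sym_diff c c'"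
  by (auto simp: chain_group_def)

lemma boundaries_cases:
  assumes "x \<in> boundaries X k"
  obtains c where "finite c" "c \<subseteq> simplices X (k + 1)" "x = chain_boundary c"
proof -
  obtain c where "c \<in> carrier (chain_group X (k + 1))" "x = chain_boundary c"
    using assms unfolding boundaries_def by blast
  then show ?thesis using that[of c] by simp
qed

lemma sym_diff_in_boundaries:
  assumes "x \<in> boundaries X k" "y \<in> boundaries X k"
  shows "sym_diff x y \<in> boundaries X k"
proof -
  obtain c c' where c: "c \<in> carrier (chain_group X (k + 1))" "x = chain_boundary c"
    and c': "c' \<in> carrier (chain_group X (k + 1))" "y = chain_boundary c'"
    using assms unfolding boundaries_def by blast
  then have "sym_diff c c' \<in> carrier (chain_group X (k + 1))" by auto
  moreover have "sym_diff x y = chain_boundary (sym_diff c c')"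
    using c c' chain_boundary_sym_diff[of c c'] by simp
  ultimately show ?thesis unfolding boundaries_def by (metis image_eqI)
qed

lemma empty_in_boundaries: "{} \<in> boundaries X k"
  unfolding boundaries_def by (rule image_eqI[of _ _ "{}"]) auto

lemma boundaries_mono:
  assumes "X \<subseteq> Y"
  shows "boundaries X k \<subseteq> boundaries Y k"
proof -
  have "simplices X (k + 1) \<subseteq> simplices Y (k + 1)" using assms unfolding simplices_def by blast
  then have "carrier (chain_group X (k + 1)) \<subseteq> carrier (chain_group Y (k + 1))"
    unfolding chain_group_def by auto
  then show ?thesis unfolding boundaries_def by (rule image_mono)
qed

lemma finite_simplex: "s \<in> simplices X k \<Longrightarrow> finite s"
  unfolding simplices_def by (intro card_ge_0_finite) simp

lemma chain_boundary_in_boundaries: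
  assumes "x \<in> boundaries X k"
  shows "chain_boundary x = {}"
proof -
  from assms obtain c where c: "finite c" "c \<subseteq> simplices X (k + 1)" "x = chain_boundary c"
    by (rule boundaries_cases)
  have "\<forall>s\<in>c. finite s" using c(2) finite_simplex by blast
  then show ?thesis using c chain_boundary_boundary by simp
qed

lemma homology_class_cases:
  assumes "\<Omega> \<in> carrier (homology X k)"
  obtains M where "M \<in> cycles X k" "\<Omega> = (\<lambda>c. sym_diff c M) ` boundaries X k"
  using assms unfolding homology_def FactGroup_def RCOSETS_def r_coset_def
  by (auto simp: chain_group_def)

text \<open>Representatives of one class differ by boundaries of \<open>X\<close>, so if one of them
  bounds in \<open>Y\<close>, all do.\<close>

lemma homology_class_trivial:
  assumes "\<Omega> \<in> carrier (homology X k)" "M \<in> \<Omega>" "M \<in> boundaries Y k"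
    and "boundaries X k \<subseteq> boundaries Y k"
  shows "\<Omega> \<subseteq> boundaries Y k"
proof -
  obtain N where N: "\<Omega> = (\<lambda>c. sym_diff c N) ` boundaries X k"
    using assms(1) by (rule homology_class_cases)
  then obtain h where h: "h \<in> boundaries X k" "M = sym_diff h N" using assms(2) by blast
  then have "N = sym_diff h M" by blast
  then have "N \<in> boundaries Y k"
    using sym_diff_in_boundaries h assms(3,4) by (metis subsetD)
  then show ?thesis unfolding N using sym_diff_in_boundaries assms(4) by blast
qed

lemma homology_class_eq_boundaries:
  assumes "\<Omega> \<in> carrier (homology X k)" "M \<in> \<Omega>" "M \<in> boundaries X k"
  shows "\<Omega> = boundaries X k"
proof
  show "\<Omega> \<subseteq> boundaries X k" using homology_class_trivial assms by blast
  obtain N where N: "\<Omega> = (\<lambda>c. sym_diff c N) ` boundaries X k"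
    using assms(1) by (rule homology_class_cases)
  have "N \<in> \<Omega>" unfolding N using empty_in_boundaries by force
  then have "N \<in> boundaries X k" using \<open>\<Omega> \<subseteq> boundaries X k\<close> by blast
  show "boundaries X k \<subseteq> \<Omega>"
  proof
    fix x assume "x \<in> boundaries X k"
    then have "sym_diff x N \<in> boundaries X k"
      using \<open>N \<in> boundaries X k\<close> by (rule sym_diff_in_boundaries)
    moreover have "x = sym_diff (sym_diff x N) N" by blast
    ultimately show "x \<in> \<Omega>" unfolding N by blast
  qed
qed

text \<open>Translating the subgroup of boundaries by its own elements gives it back.
  \<open>M\<close> witnesses that \<open>\<Omega>\<close> is nonempty, without which the product of
  sets would be empty.\<close>

lemma homology_incl_trivial:
  assumes "\<Omega> \<subseteq> boundaries Y k" "M \<in> \<Omega>"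
  shows "homology_incl Y k \<Omega> = boundaries Y k"
proof
  show "homology_incl Y k \<Omega> \<subseteq> boundaries Y k"
    using assms sym_diff_in_boundaries[of _ Y k] unfolding homology_incl_def set_mult_def by auto
  show "boundaries Y k \<subseteq> homology_incl Y k \<Omega>"
  proof
    fix x assume "x \<in> boundaries Y k"
    then have "sym_diff x M \<in> boundaries Y k" using assms sym_diff_in_boundaries by blast
    moreover have "x = sym_diff (sym_diff x M) M" by blast
    ultimately show "x \<in> homology_incl Y k \<Omega>"
      using assms(2) unfolding homology_incl_def set_mult_def by auto
  qed
qed

lemma boundaries_in_homology: "boundaries X k \<in> carrier (homology X k)"
proof -
  have "{} \<in> cycles X k" unfolding cycles_def by simp
  then have "boundaries X k #>\<^bsub>chain_group X k\<lparr>carrier := cycles X k\<rparr>\<^esub> {}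
      \<in> carrier (homology X k)"
    unfolding homology_def FactGroup_def RCOSETS_def by auto
  moreover have "boundaries X k #>\<^bsub>chain_group X k\<lparr>carrier := cycles X k\<rparr>\<^esub> {} = boundaries X k"
    unfolding r_coset_def by simp
  ultimately show ?thesis by simp
qed

text \<open>The other members of a class arise by adding boundaries to a cycle; closure of
  \<open>X\<close> under faces ensures that these boundaries consist of simplices of
  \<open>X\<close>.\<close>

lemma homology_class_cycle:
  assumes "\<Omega> \<in> carrier (homology X k)" "M \<in> \<Omega>"
    and "\<And>s t. s \<in> X \<Longrightarrow> t \<subseteq> s \<Longrightarrow> t \<noteq> {} \<Longrightarrow> t \<in> X"
  shows "M \<in> cycles X k"
proof -
  obtain N where N: "N \<in> cycles X k" "\<Omega> = (\<lambda>c. sym_diff c N) ` boundaries X k"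
    using assms(1) by (rule homology_class_cases)
  then obtain h where h: "h \<in> boundaries X k" "M = sym_diff h N" using assms(2) by blast
  from h(1) obtain c where c: "finite c" "c \<subseteq> simplices X (k + 1)" "h = chain_boundary c"
    by (rule boundaries_cases)
  have fin: "\<forall>s\<in>c. finite s"
    using c(2) finite_simplex by blast
  have "finite h" using finite_chain_boundary c fin by simp
  moreover have "h \<subseteq> simplices X k"
  proof
    fix t assume "t \<in> h"
    then obtain s v where "s \<in> c" "v \<in> s" "t = s - {v}" "t \<noteq> {}"
      unfolding c(3) by (rule chain_boundary_face)
    then show "t \<in> simplices X k"
      using c(2) fin assms(3)[of s t] unfolding simplices_def by auto
  qed
  ultimately show ?thesis
    using N(1) h chain_boundary_sym_diff[of h N] chain_boundary_in_boundaries[OF h(1)]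
    unfolding cycles_def by auto
qed

section \<open>The scale at which a cycle of given width bounds\<close>

context pair_graph
begin

text \<open>The zero class always counts as earlier: by definition for \<open>b = 0\<close>, and
  otherwise as the image of the zero class. Hence a class that has become zero has died.\<close>

lemma boundaries_in_earlier_classes:
  assumes "b \<le> n"
  shows "boundaries (power_complex G n) k \<in> earlier_classes G k b n"
proof (cases "b = 0")
  case True
  then show ?thesis unfolding earlier_classes_def homology_def by (simp add: FactGroup_def)
next
  case False
  let ?B = "boundaries (power_complex G (b - 1)) k"
  have "?B \<subseteq> boundaries (power_complex G n) k"
    using assms by (intro boundaries_mono power_complex_mono) simp
  then have "homology_incl (power_complex G n) k ?B = boundaries (power_complex G n) k"
    using homology_incl_trivial empty_in_boundaries by blast
  then show ?thesis
    unfolding earlier_classes_def using False boundaries_in_homology by (auto intro: rev_image_eqI)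
qed

text \<open>Take \<open>v\<close> attaining the minimum in \<open>cycle_width\<close>; two vertices
  equally far from \<open>v\<close> share a slice. The bound is put in terms of pairs so that slices
  need not appear again.\<close>

lemma slice_dist_le_cycle_width:
  assumes "finite M" "M \<noteq> {}" "\<And>s. s \<in> M \<Longrightarrow> s \<noteq> {} \<and> finite s"
  obtains v where "v \<in> chain_verts M"
    "\<And>x y. x \<in> chain_verts M \<Longrightarrow> y \<in> chain_verts M \<Longrightarrow> power_dist G b v x = power_dist G b v y \<Longrightarrow>
      power_dist G b x y \<le> cycle_width G b M"
proof -
  let ?V = "chain_verts M"
  have V: "finite ?V" "?V \<noteq> {}" using assms unfolding chain_verts_def by fast+
  let ?w = "\<lambda>v. Max ((\<lambda>i. set_diam G b (slice G b M v i)) ` {0..eccentricity G b M v})"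
  have "cycle_width G b M \<in> ?w ` ?V"
    unfolding cycle_width_def using V by (intro Min_in) auto
  then obtain v where v: "v \<in> ?V" "cycle_width G b M = ?w v" by blast
  show ?thesis
  proof (rule that[OF v(1)])
    fix x y assume xy: "x \<in> ?V" "y \<in> ?V" "power_dist G b v x = power_dist G b v y"
    let ?i = "power_dist G b v x"
    let ?S = "slice G b M v ?i"
    have S: "x \<in> ?S" "y \<in> ?S" "finite ?S" using xy V unfolding slice_def by auto
    have "{power_dist G b y y' |y y'. y \<in> ?S \<and> y' \<in> ?S} =
        (\<lambda>(y, y'). power_dist G b y y') ` (?S \<times> ?S)" by auto
    then have "finite {power_dist G b y y' |y y'. y \<in> ?S \<and> y' \<in> ?S}"
      using S(3) by (simp only:) simp
    then have "power_dist G b x y \<le> set_diam G b ?S"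
      using S unfolding set_diam_def by (auto intro!: Max_ge)
    also have "?i \<le> eccentricity G b M v"
      unfolding eccentricity_def using V xy by (intro Max_ge) auto
    then have "set_diam G b ?S \<le> ?w v" by (intro Max_ge) auto
    finally show "power_dist G b x y \<le> cycle_width G b M" using v(2) by simp
  qed
qed

text \<open>A ceiling is at most an integer iff its argument is, which trades rounded distances for
  exact inequalities. Positivity of \<open>b\<close> excludes division by zero.\<close>

lemma power_dist_le_iff:
  assumes "b > 0"
  shows "power_dist G b x y \<le> n \<longleftrightarrow> graph_dist G x y \<le> n * b"
proof -
  have "power_dist G b x y \<le> n \<longleftrightarrow> real (graph_dist G x y) / real b \<le> real n"
    unfolding power_dist_def by (simp add: nat_le_iff ceiling_le_iff)
  also have "\<dots> \<longleftrightarrow> real (graph_dist G x y) \<le> real (n * b)"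
    using assms by (simp add: pos_divide_le_eq)
  finally show ?thesis by (simp only: of_nat_le_iff)
qed

text \<open>Within one level distances are at most the width times \<open>b\<close>, and crossing a
  simplex of \<open>M\<close> to the next level costs another \<open>b\<close>. This is the origin
  of the factor width plus one.\<close>

lemma cycle_bounds_at_width:
  assumes conn: "Digraph_Component.connected (with_proj G)"
    and "2 \<le> k" and M: "M \<in> cycles (power_complex G b) k" "M \<noteq> {}"
  shows "M \<in> boundaries (power_complex G ((cycle_width G b M + 1) * b)) k"
proof -
  let ?V = "chain_verts M" and ?w = "cycle_width G b M"
  have finM: "finite M" and M_sub: "M \<subseteq> simplices (power_complex G b) k"
    and cyc: "chain_boundary M = {}"
    using M unfolding cycles_def by auto
  have MX: "s \<in> power_complex G b \<and> card s = k + 1" if "s \<in> M" for s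
    using M_sub that unfolding simplices_def by blast
  have sub: "?V \<subseteq> pverts G" using MX unfolding chain_verts_def by (auto simp: power_complex_iff)
  have fin: "s \<noteq> {} \<and> finite s" if "s \<in> M" for s
    using MX[OF that] by (auto intro!: card_ge_0_finite)
  have adj: "graph_dist G x y \<le> b" if "s \<in> M" "x \<in> s" "y \<in> s" for s x y
  proof -
    have "x \<in> pverts G" using sub that unfolding chain_verts_def by blast
    then show ?thesis
      using MX[OF that(1)] that graph_dist_eq_0_iff[OF conn, of x x]
      by (cases "x = y") (auto simp: power_complex_iff)
  qed
  \<comment> \<open>At scale 0 every simplex is a single vertex, whereas those of \<open>M\<close>
    have at least three.\<close>
  have "b > 0"
  proof (rule ccontr)
    assume "\<not> b > 0"
    obtain s where s: "s \<in> M" using M by blast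
    have "x = y" if "x \<in> s" "y \<in> s" for x y
      using adj[OF s that] \<open>\<not> b > 0\<close> graph_dist_eq_0_iff[OF conn, of x y] sub s that
      unfolding chain_verts_def by blast
    then have "card s \<le> 1" using fin[OF s] by (auto simp: card_le_Suc0_iff_eq)
    then show False using MX[OF s] \<open>2 \<le> k\<close> by simp
  qed
  obtain v where v: "v \<in> ?V" and thin: "\<And>x y. x \<in> ?V \<Longrightarrow> y \<in> ?V \<Longrightarrow>
      power_dist G b v x = power_dist G b v y \<Longrightarrow> power_dist G b x y \<le> ?w"
    using slice_dist_le_cycle_width[OF finM M(2) fin, of b] by blast
  have near: "graph_dist G x y \<le> ?w * b"
    if "x \<in> ?V" "y \<in> ?V" "power_dist G b v x = power_dist G b v y" for x y
    using thin[OF that] power_dist_le_iff[OF \<open>b > 0\<close>] by blast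
  have tri: "graph_dist G x z \<le> graph_dist G x y + graph_dist G y z"
    if "x \<in> ?V" "y \<in> ?V" "z \<in> ?V" for x y z
    using graph_dist_triangle[OF conn] sub that by blast
  \<comment> \<open>Moving within a simplex adds at most \<open>b\<close> to the distance from
    \<open>v\<close>, hence at most one to the rounded distance.\<close>
  have level: "power_dist G b v y \<le> power_dist G b v x + 1" if "s \<in> M" "x \<in> s" "y \<in> s" for s x y
  proof -
    have "x \<in> ?V" "y \<in> ?V" using that unfolding chain_verts_def by auto
    then have "graph_dist G v y \<le> graph_dist G v x + b"
      using tri[OF v, of x y] adj[OF that] by simp
    also have "\<dots> \<le> (power_dist G b v x + 1) * b"
      using power_dist_le_iff[OF \<open>b > 0\<close>, of v x "power_dist G b v x"] by simp
    finally show ?thesis using power_dist_le_iff[OF \<open>b > 0\<close>] by blast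
  qed
  have fill: "t \<in> power_complex G ((?w + 1) * b)"
    if t: "t \<subseteq> {u \<in> ?V. power_dist G b v u = n} \<union>
          {u \<in> ?V. power_dist G b v u = Suc n \<and> (\<exists>s\<in>M. u \<in> s \<and> (\<exists>x\<in>s. power_dist G b v x = n))}"
      and "finite t" "card t = k + 2" for n t
  proof -
    have V: "x \<in> ?V" if "x \<in> t" for x using t that by blast
    have dich: "power_dist G b v x = n \<or> power_dist G b v x = Suc n \<and>
        (\<exists>s\<in>M. x \<in> s \<and> (\<exists>u\<in>s. power_dist G b v u = n))" if "x \<in> t" for x
      using t that by blast
    have "graph_dist G x y \<le> ?w * b + b" if xy: "x \<in> t" "y \<in> t" for x y
    proof -
      \<comment> \<open>Vertices on different levels are compared through \<open>u\<close>: it lies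
        on level \<open>n\<close> with one of them and in a simplex of \<open>M\<close> with the
        other.\<close>
      consider "power_dist G b v x = power_dist G b v y"
        | s u where "power_dist G b v x = n" "s \<in> M" "y \<in> s" "u \<in> s" "power_dist G b v u = n"
        | s u where "power_dist G b v y = n" "s \<in> M" "x \<in> s" "u \<in> s" "power_dist G b v u = n"
        using dich[OF xy(1)] dich[OF xy(2)] by metis
      then show ?thesis
      proof cases
        case 1
        then show ?thesis using near[of x y] V xy by simp
      next
        case 2
        then have "u \<in> ?V" unfolding chain_verts_def by blast
        then show ?thesis
          using tri[of x u y] near[of x u] adj[of s u y] 2 V[OF xy(1)] V[OF xy(2)] by simp
      next
        case 3
        then have "u \<in> ?V" unfolding chain_verts_def by blast
        then show ?thesis
          using tri[of x u y] near[of u y] adj[of s x u] 3 V[OF xy(1)] V[OF xy(2)] by simp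
      qed
    qed
    moreover have "t \<noteq> {}" using that(3) by force
    moreover have "t \<subseteq> pverts G" using V sub by blast
    ultimately show ?thesis unfolding power_complex_iff by (simp add: add.commute)
  qed
  have card: "card s = k + 1" if "s \<in> M" for s using MX[OF that] by blast
  obtain c where c: "finite c" "c \<subseteq> power_complex G ((?w + 1) * b)" "\<forall>s\<in>c. card s = k + 2"
    "chain_boundary c = M"
    by (rule swept_cycle_bounds[where f = "power_dist G b v" and k = k
          and X = "power_complex G ((?w + 1) * b)", OF finM card \<open>2 \<le> k\<close> cyc])
      (assumption | erule (2) level | erule (2) fill)+
  then have "c \<in> carrier (chain_group (power_complex G ((?w + 1) * b)) (k + 1))"
    by (auto simp: simplices_def)
  then show ?thesis unfolding boundaries_def using c(4) by blast
qed

end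

section \<open>Death times in the persistence diagram\<close>

theorem theorem7p1:
  fixes G :: "'a pair_pre_digraph"
    and k b :: nat
    and d :: enat
    and P :: "(nat \<times> enat) multiset"
    and \<Omega> :: "'a set set set"
  assumes "pair_graph G"
    and "Digraph_Component.connected (with_proj G)"
    and "k \<ge> 2"
    and "is_PD G k P"
    and "(b, d) \<in># P"
    and "corresponds G k b d \<Omega>"
  shows "d \<le> enat ((class_width G b \<Omega> + 1) * b)"
proof -
  interpret pair_graph G by fact
  let ?X = "power_complex G" and ?D = "graph_diam G"
  have \<Omega>: "\<Omega> \<in> carrier (homology (?X b) k)" "\<Omega> \<notin> earlier_classes G k b b"
    and d: "d = (INF n \<in> {n. b < n \<and> n \<le> ?D \<and>
        homology_incl (?X n) k \<Omega> \<in> earlier_classes G k b n}. enat n)"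
    using assms(6) unfolding corresponds_def by auto
  \<comment> \<open>A bounding representative would make \<open>\<Omega>\<close> the zero class,
    which is always earlier, contradicting birth at \<open>b\<close>.\<close>
  have nontrivial: "M \<notin> boundaries (?X b) k" if "M \<in> \<Omega>" for M
    using homology_class_eq_boundaries[OF \<Omega>(1) that] boundaries_in_earlier_classes[of b b k] \<Omega>(2)
    by auto
  have cyc: "M \<in> cycles (?X b) k" if "M \<in> \<Omega>" for M
    using homology_class_cycle[OF \<Omega>(1) that] power_complex_iff by (metis subset_iff)
  \<comment> \<open>Finiteness of the vertex set makes \<open>\<Omega>\<close> finite, so that the
    \<open>Min\<close> in \<open>class_width\<close> is attained by some cycle.\<close>
  have "simplices (?X b) k \<subseteq> Pow (pverts G)"
    unfolding simplices_def by (auto simp: power_complex_iff)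
  then have "cycles (?X b) k \<subseteq> Pow (Pow (pverts G))"
    unfolding cycles_def chain_group_def by auto
  then have "finite \<Omega>"
    using cyc by (meson finite_Pow_iff finite_subset finite_verts subsetI)
  moreover have "\<Omega> \<noteq> {}"
    using homology_class_cases[OF \<Omega>(1)] empty_in_boundaries by (metis empty_iff image_is_empty)
  ultimately have "class_width G b \<Omega> \<in> cycle_width G b ` \<Omega>"
    unfolding class_width_def by (intro Min_in) auto
  then obtain M where M: "M \<in> \<Omega>" "class_width G b \<Omega> = cycle_width G b M" by blast
  have "M \<noteq> {}" using nontrivial[OF M(1)] empty_in_boundaries by metis
  \<comment> \<open>Truncation at the diameter keeps \<open>n\<close> among the indices of the
    filtration and does not change the complex.\<close>
  define n where "n = min ((class_width G b \<Omega> + 1) * b) ?D"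
  have bounds: "M \<in> boundaries (?X n) k"
    using cycle_bounds_at_width[OF assms(2,3) cyc[OF M(1)] \<open>M \<noteq> {}\<close>]
    unfolding n_def power_complex_min_diam M(2) .
  \<comment> \<open>The infimum defining \<open>d\<close> ranges over indices above
    \<open>b\<close>. If \<open>n\<close> were at most \<open>b\<close>, monotonicity would make
    \<open>M\<close> bound already at scale \<open>b\<close>.\<close>
  have "b < n"
    using nontrivial[OF M(1)] bounds boundaries_mono[OF power_complex_mono]
    by (meson not_le subsetD)
  then have "\<Omega> \<subseteq> boundaries (?X n) k"
    using homology_class_trivial[OF \<Omega>(1) M(1) bounds] boundaries_mono[OF power_complex_mono]
    by simp
  then have "homology_incl (?X n) k \<Omega> = boundaries (?X n) k"
    using M(1) by (rule homology_incl_trivial)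
  then have "homology_incl (?X n) k \<Omega> \<in> earlier_classes G k b n"
    using boundaries_in_earlier_classes[of b n k] \<open>b < n\<close> by simp
  then have "d \<le> enat n"
    unfolding d using \<open>b < n\<close> by (intro INF_lower) (simp add: n_def)
  also have "\<dots> \<le> enat ((class_width G b \<Omega> + 1) * b)" unfolding n_def by simp
  finally show ?thesis .
qed

end
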